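(* Let $f: \mathbb{N} \to [1,\infty)$ be any function such that $f(n) \to \infty$ as $n \to \infty$. Then there exists a non-decreasing sequence $(a_n)_{n \ge 1}$ of (non-negative) integer step sizes for which $a_n \le f(n)$ for all $n\ge1$ and the associated Rademacher random walk is both irreducible and transient.
   Context: Let $\epsilon_1, \epsilon_2, \dots$ be independent Rademacher random variables, taking values $\pm 1$ each with probability $1/2$. The Rademacher random walk associated with a deterministic sequence $(a_n)_{n\ge1}$ of non-negative reals is $(X_n)_{n\ge 0}$, $X_n = \sum_{k=1}^n \epsilon_k a_k$. The walk is weakly recurrent if $\mathbb{P}(\exists C<\infty : |X_n| \le C \text{ for infinitely many } n) = 1$; otherwise it is called transient (the event is a tail event, so by Kolmogorov's zero-one law transience means its probability is $0$). An integer-valued random walk $(X_n)$ is irreducible if, for any $a,b \in\mathbb{Z}$ and any $n \in \mathbb{N}$ such that $\mathbb{P}(X_n = a) > 0$, there is some $m > n$ such that $\mathbb{P}(X_m = b \mid X_n = a) > 0$. *)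

theory Defs
  imports "HOL-Probability.Probability"
begin

locale rademacher_sequence = prob_space M for M :: "'a measure" +
  fixes \<epsilon> :: "nat \<Rightarrow> 'a \<Rightarrow> real"
  assumes indep: "indep_vars (\<lambda>_. borel) \<epsilon> {1..}"
    and prob_plus: "\<And>k. k \<ge> 1 \<Longrightarrow> \<P>(\<omega> in M. \<epsilon> k \<omega> = 1) = 1/2"
    and prob_minus: "\<And>k. k \<ge> 1 \<Longrightarrow> \<P>(\<omega> in M. \<epsilon> k \<omega> = -1) = 1/2"

definition rademacher_walk ::
  "(nat \<Rightarrow> 'a \<Rightarrow> real) \<Rightarrow> (nat \<Rightarrow> real) \<Rightarrow> nat \<Rightarrow> 'a \<Rightarrow> real" where
  "rademacher_walk \<epsilon> a n \<omega> = (\<Sum>k=1..n. \<epsilon> k \<omega> * a k)"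

(* The bound C may depend on the sample point. *)
definition weakly_recurrent :: "'a measure \<Rightarrow> (nat \<Rightarrow> 'a \<Rightarrow> real) \<Rightarrow> bool" where
  "weakly_recurrent M X \<longleftrightarrow>
     \<P>(\<omega> in M. \<exists>C::real. \<exists>\<^sub>\<infinity>n. \<bar>X n \<omega>\<bar> \<le> C) = 1"

definition transient :: "'a measure \<Rightarrow> (nat \<Rightarrow> 'a \<Rightarrow> real) \<Rightarrow> bool" where
  "transient M X \<longleftrightarrow> \<not> weakly_recurrent M X"

(* Intended for walks that are almost surely integer-valued, although X is typed as
   real-valued. *)
definition irreducible_walk :: "'a measure \<Rightarrow> (nat \<Rightarrow> 'a \<Rightarrow> real) \<Rightarrow> bool" where
  "irreducible_walk M X \<longleftrightarrow>
     (\<forall>(a::int) (b::int) n. \<P>(\<omega> in M. X n \<omega> = of_int a) > 0 \<longrightarrow>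
        (\<exists>m>n. \<P>(\<omega> in M. X m \<omega> = of_int b \<bar> X n \<omega> = of_int a) > 0))"

(* The event in the definition of weak recurrence is measurable, so its measure is
   not the default value 0 assigned to non-measurable sets. *)
lemma weakly_recurrent_event_measurable:
  assumes "rademacher_sequence M \<epsilon>"
  shows "{\<omega> \<in> space M. \<exists>C::real. \<exists>\<^sub>\<infinity>n. \<bar>rademacher_walk \<epsilon> a n \<omega>\<bar> \<le> C} \<in> sets M"
proof -
  interpret rademacher_sequence M \<epsilon> by fact
  have e: "\<epsilon> k \<in> borel_measurable M" if "k \<ge> 1" for k
    using indep that by (auto simp: indep_vars_def)
  have X [measurable]: "rademacher_walk \<epsilon> a n \<in> borel_measurable M" for n
    unfolding rademacher_walk_def by (intro borel_measurable_sum borel_measurable_times e) auto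
  have "(\<exists>C::real. \<exists>\<^sub>\<infinity>n. \<bar>x n\<bar> \<le> C) \<longleftrightarrow> (\<exists>c::nat. \<forall>N. \<exists>n>N. \<bar>x n\<bar> \<le> real c)"
    for x :: "nat \<Rightarrow> real"
    unfolding INFM_nat by (meson order_trans real_arch_simple)
  then show ?thesis by simp
qed

end

theory Submission
  imports Defs "HOL-Number_Theory.Cong"
begin


text \<open>
  The steps are arranged in consecutive blocks; all steps of block \<open>i\<close> have size
  \<open>s\<^sub>i = 2 ^ (i + 1) - 1\<close>, so that the sizes are 1, 3, 7, 15, and so on. The block boundaries
  \<open>T i\<close> are free, and since only lower bounds on the block lengths are needed, block \<open>i\<close> can be
  postponed until the growth bound \<open>f\<close> exceeds \<open>s\<^sub>i\<close> for good.

  Transience comes from arithmetic modulo the step size. Throughout block \<open>i\<close> the position modulo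
  \<open>s\<^sub>i\<close> does not change, so the walk can come within distance \<open>C\<close> of the origin during that block
  only if it enters the block in one of at most \<open>2 C + 1\<close> residue classes modulo \<open>s\<^sub>i\<close>, however long the
  block lasts. Block \<open>i - 1\<close> has steps of size \<open>s\<^sub>i\<^sub>-\<^sub>1\<close>, which is coprime to the odd number
  \<open>s\<^sub>i\<close>; hence the position modulo \<open>s\<^sub>i\<close> performs an irreducible aperiodic random walk on a cycle, and
  if block \<open>i - 1\<close> is long enough, each class has probability at most \<open>2 / s\<^sub>i\<close> at its end
  (\<open>averaging_mixes\<close>, \<open>spreads_within_exists\<close>). The chance to see \<open>[-C, C]\<close> in block
  \<open>i\<close> is therefore \<open>O(C / s\<^sub>i)\<close>. This is summable, and the Borel-Cantelli lemma applies
  (\<open>transient_if_residues_spread\<close>).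

  Irreducibility comes from \<open>s\<^sub>i\<^sub>+\<^sub>1 - 2 s\<^sub>i = 1\<close>: two steps at the end of a block against one step
  at the start of the next change the position by one unit in either direction, and alternating signs
  cancel all other steps when the block lengths are odd. Passing through sufficiently many blocks,
  the walk can reach every integer (\<open>reach\<close>).
\<close>

section \<open>Step sizes\<close>

definition step_size :: "nat \<Rightarrow> nat" where
  "step_size i = 2 ^ Suc i - 1"

lemma step_size_Suc: "step_size (Suc i) = 2 * step_size i + 1"
proof -
  have "(2::nat) ^ i \<ge> 1" by simp
  then show ?thesis unfolding step_size_def power_Suc by linarith
qed

lemma step_size_0: "step_size 0 = 1"
  by (simp add: step_size_def)

lemma odd_step_size: "odd (step_size i)"
  by (cases i) (simp_all add: step_size_Suc step_size_0)

lemma coprime_step_size: "coprime (step_size i) (step_size (Suc i))"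
  unfolding step_size_Suc
  by (metis coprime_1_right coprime_iff_gcd_eq_1 gcd_add_mult mult.commute add.commute)

lemma step_size_ge: "2 ^ i \<le> step_size i"
  by (induction i) (simp_all add: step_size_Suc step_size_0)

lemma mono_step_size: "i \<le> j \<Longrightarrow> step_size i \<le> step_size j"
  unfolding step_size_def by (intro diff_le_mono power_increasing) auto

section \<open>Mixing of a symmetric walk on a cycle\<close>

text \<open>
  The law \<open>q k r\<close> of the residue at time \<open>k\<close> of a walk with steps \<open>\<plusminus>a\<close> satisfies
  \<open>q (k + 1) r = (q k (r - a) + q k (r + a)) / 2\<close>. Only this recursion is used here. It is linear and
  preserves constants, so it is inherited by the difference between a constant and \<open>q\<close>. For a
  non-negative solution \<open>g\<close>, following a single one of the \<open>2 ^ k\<close> paths gives a lower bound; \<open>j\<close> below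
  is the number of upward steps of the path.
\<close>

lemma averaging_lower_bound:
  fixes g :: "nat \<Rightarrow> int \<Rightarrow> real"
  assumes avg: "\<And>k r. k < m \<Longrightarrow> g (Suc k) r = (g k (r - a) + g k (r + a)) / 2"
    and pos: "\<And>k r. g k r \<ge> 0"
    and "n + k \<le> m" "j \<le> k"
  shows "g n (r + (2 * int j - int k) * a) / 2 ^ k \<le> g (n + k) r"
  using assms(3,4)
proof (induction k arbitrary: j r)
  case 0
  then show ?case by simp
next
  case (Suc k)
  show ?case
  proof (cases "j \<le> k")
    case True
    have "g n (r - a + (2 * int j - int k) * a) / 2 ^ k \<le> g (n + k) (r - a)"
      using Suc.IH[of j "r - a"] Suc.prems True by simp
    moreover have "r - a + (2 * int j - int k) * a = r + (2 * int j - int (Suc k)) * a"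
      by (simp add: algebra_simps)
    ultimately have "g n (r + (2 * int j - int (Suc k)) * a) / 2 ^ k \<le> g (n + k) (r - a)"
      by metis
    then have "g n (r + (2 * int j - int (Suc k)) * a) / 2 ^ Suc k \<le> g (n + k) (r - a) / 2"
      by (simp add: field_simps)
    also have "\<dots> \<le> (g (n + k) (r - a) + g (n + k) (r + a)) / 2"
      using pos by simp
    also have "\<dots> = g (n + Suc k) r"
      using avg[of "n + k" r] Suc.prems by simp
    finally show ?thesis .
  next
    case False
    then have j: "j = Suc k" using Suc.prems by simp
    have "g n (r + a + (2 * int k - int k) * a) / 2 ^ k \<le> g (n + k) (r + a)"
      using Suc.IH[of k "r + a"] Suc.prems by simp
    moreover have "r + a + (2 * int k - int k) * a = r + (2 * int j - int (Suc k)) * a"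
      by (simp add: j algebra_simps)
    ultimately have "g n (r + (2 * int j - int (Suc k)) * a) / 2 ^ k \<le> g (n + k) (r + a)"
      by metis
    then have "g n (r + (2 * int j - int (Suc k)) * a) / 2 ^ Suc k \<le> g (n + k) (r + a) / 2"
      by (simp add: field_simps)
    also have "\<dots> \<le> (g (n + k) (r - a) + g (n + k) (r + a)) / 2"
      using pos by simp
    also have "\<dots> = g (n + Suc k) r"
      using avg[of "n + k" r] Suc.prems by simp
    finally show ?thesis .
  qed
qed

text \<open>
  The end points of all paths of length \<open>s - 1\<close> form an arithmetic progression with \<open>s\<close> terms and
  common difference \<open>2 * a\<close>. As \<open>2 * a\<close> is invertible modulo \<open>s\<close>, it meets every residue class.
\<close>

lemma walk_covers_residues:
  fixes a r y :: int and s :: nat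
  assumes "odd s" "coprime a (int s)"
  shows "\<exists>j \<le> s - 1. [r + (2 * int j - int (s - 1)) * a = y] (mod int s)"
proof -
  have s0: "s > 0" using assms(1) by (cases s) auto
  have "coprime (2 * a) (int s)"
    using assms by (simp add: coprime_left_2_iff_odd)
  then obtain x where x: "[2 * a * x = 1] (mod int s)"
    using cong_solve_coprime_int by blast
  define z where "z = y - r + int (s - 1) * a"
  define j where "j = nat ((x * z) mod int s)"
  have j: "int j = (x * z) mod int s" "j < s"
    using s0 by (simp_all add: j_def nat_less_iff)
  have "[2 * a * int j = 2 * a * (x * z)] (mod int s)"
    unfolding j by (intro cong_mult) auto
  moreover have "[(2 * a * x) * z = 1 * z] (mod int s)"
    by (intro cong_mult x) auto
  ultimately have "[2 * a * int j = z] (mod int s)"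
    by (metis cong_trans mult.assoc mult_1)
  then have "[(r - int (s - 1) * a) + 2 * a * int j = (r - int (s - 1) * a) + z] (mod int s)"
    by (intro cong_add) auto
  moreover have "(r - int (s - 1) * a) + 2 * a * int j = r + (2 * int j - int (s - 1)) * a"
    by (simp add: algebra_simps)
  moreover have "(r - int (s - 1) * a) + z = y" by (simp add: z_def)
  ultimately have "[r + (2 * int j - int (s - 1)) * a = y] (mod int s)" by metis
  then show ?thesis using j(2) by (intro exI[of _ j]) auto
qed

text \<open>
  Some class carries at most the average mass \<open>1 / s\<close>, and it influences every class after \<open>s - 1\<close> steps
  with weight at least \<open>1 / 2 ^ (s - 1)\<close>. Hence the excess of the maximum of \<open>q\<close> over \<open>1 / s\<close>
  shrinks by a constant factor.
\<close>

lemma averaging_contracts: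
  fixes q :: "nat \<Rightarrow> int \<Rightarrow> real" and s :: nat
  assumes s: "odd s" "coprime a (int s)"
    and avg: "\<And>k r. k < m \<Longrightarrow> q (Suc k) r = (q k (r - a) + q k (r + a)) / 2"
    and periodic: "\<And>k r r'. [r = r'] (mod int s) \<Longrightarrow> q k r = q k r'"
    and mass: "\<And>k. (\<Sum>r<s. q k (int r)) \<le> 1"
    and bound: "\<And>k r. q k r \<le> 1 / s + d"
    and n: "n + (s - 1) \<le> m"
  shows "q (n + (s - 1)) r \<le> 1 / s + (1 - 1 / 2 ^ (s - 1)) * d"
proof -
  have s0: "s > 0" using s(1) by (cases s) auto
  obtain y where y: "q n (int y) \<le> 1 / s"
  proof (rule ccontr)
    assume "\<not> thesis"
    then have "\<And>y. 1 / s < q n (int y)" by (meson not_le_imp_less that)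
    then have "(\<Sum>r<s. 1 / s) < (\<Sum>r<s. q n (int r))"
      using s0 by (intro sum_strict_mono) auto
    with mass[of n] s0 show False by simp
  qed
  obtain j where j: "j \<le> s - 1" "[r + (2 * int j - int (s - 1)) * a = int y] (mod int s)"
    using walk_covers_residues[OF s] by blast
  \<comment> \<open>The deficit below the upper bound is a non-negative solution of the same recursion.\<close>
  define g where "g k r = 1 / s + d - q k r" for k r
  have "g n (r + (2 * int j - int (s - 1)) * a) / 2 ^ (s - 1) \<le> g (n + (s - 1)) r"
    by (rule averaging_lower_bound[of m])
       (use avg bound j n in \<open>auto simp: g_def field_simps\<close>)
  then have "g n (int y) / 2 ^ (s - 1) \<le> g (n + (s - 1)) r"
    using periodic[OF j(2)] by (simp add: g_def)
  moreover have "d / 2 ^ (s - 1) \<le> g n (int y) / 2 ^ (s - 1)"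
    using y by (intro divide_right_mono) (auto simp: g_def)
  ultimately show ?thesis by (simp add: g_def algebra_simps)
qed



text \<open>
  Iterating the contraction gives the bound at a fixed time; averaging never increases the maximum, so
  the bound persists afterwards. The time \<open>L\<close> depends on \<open>a\<close> and \<open>s\<close> only, and not on the initial
  distribution, which permits restarting the argument at the beginning of each block. The recursion is
  required up to time \<open>m\<close> only because the step size changes when the block ends.
\<close>

lemma averaging_mixes:
  fixes a :: int and s :: nat
  assumes s: "odd s" "coprime a (int s)"
  obtains L where "\<And>(q :: nat \<Rightarrow> int \<Rightarrow> real) m r. L \<le> m \<Longrightarrow>
     (\<And>k r. k < m \<Longrightarrow> q (Suc k) r = (q k (r - a) + q k (r + a)) / 2) \<Longrightarrow>
     (\<And>k r r'. [r = r'] (mod int s) \<Longrightarrow> q k r = q k r') \<Longrightarrow>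
     (\<And>k. (\<Sum>r<s. q k (int r)) \<le> 1) \<Longrightarrow> (\<And>k r. q k r \<le> 1) \<Longrightarrow> q m r \<le> 2 / s"
proof -
  have s0: "s > 0" using s(1) by (cases s) auto
  define \<rho> where "\<rho> = (1 - 1 / 2 ^ (s - 1) :: real)"
  have \<rho>: "0 \<le> \<rho>" "\<rho> < 1" by (simp_all add: \<rho>_def)
  obtain t where t: "\<rho> ^ t < 1 / s"
    using real_arch_pow_inv[of "1 / s" \<rho>] \<rho> s0 by auto
  show ?thesis
  proof (rule that[of "t * (s - 1)"])
    fix q :: "nat \<Rightarrow> int \<Rightarrow> real" and m r
    assume m: "t * (s - 1) \<le> m"
      and avg: "\<And>k r. k < m \<Longrightarrow> q (Suc k) r = (q k (r - a) + q k (r + a)) / 2"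
      and periodic: "\<And>k r r'. [r = r'] (mod int s) \<Longrightarrow> q k r = q k r'"
      and mass: "\<And>k. (\<Sum>r<s. q k (int r)) \<le> 1" and le1: "\<And>k r. q k r \<le> 1"
    have persist: "n \<le> k \<Longrightarrow> k \<le> m \<Longrightarrow> (\<And>r. q n r \<le> c) \<Longrightarrow> q k r \<le> c" for n k c r
    proof (induction k arbitrary: r rule: dec_induct)
      case (step k)
      then have "q k (r - a) \<le> c" "q k (r + a) \<le> c" by auto
      then have "(q k (r - a) + q k (r + a)) / 2 \<le> (c + c) / 2"
        by (intro divide_right_mono add_mono) auto
      moreover have "q (Suc k) r = (q k (r - a) + q k (r + a)) / 2"
        using avg step.prems by simp
      ultimately show ?case by simp
    qed
    have "j * (s - 1) \<le> m \<Longrightarrow> q (j * (s - 1)) r \<le> 1 / s + \<rho> ^ j" for j r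
    proof (induction j arbitrary: r)
      case 0
      then show ?case using le1 by (simp add: add_increasing)
    next
      case (Suc j)
      let ?n = "j * (s - 1)"
      \<comment> \<open>Time starts at \<open>?n\<close> and is frozen at \<open>m\<close>, beyond which \<open>q\<close> is not controlled.\<close>
      define q' where "q' k r = q (min m (?n + k)) r" for k r
      have "q' (0 + (s - 1)) r \<le> 1 / s + (1 - 1 / 2 ^ (s - 1)) * \<rho> ^ j"
      proof (rule averaging_contracts[OF s])
        fix k r assume "k < s - 1"
        then show "q' (Suc k) r = (q' k (r - a) + q' k (r + a)) / 2"
          using avg Suc.prems by (simp add: q'_def)
      next
        fix k r r' assume "[r = r'] (mod int s)"
        then show "q' k r = q' k r'" unfolding q'_def using periodic by blast
      next
        fix k r
        show "q' k r \<le> 1 / s + \<rho> ^ j" unfolding q'_def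
          by (rule persist[of ?n]) (use Suc in auto)
      qed (use mass in \<open>simp_all add: q'_def\<close>)
      then show ?case using Suc.prems by (simp add: q'_def \<rho>_def add.commute)
    qed
    then have "q (t * (s - 1)) r \<le> 2 / s" for r
      using t m by (smt (verit) add_divide_distrib)
    then show "q m r \<le> 2 / s"
      using persist m by blast
  qed
qed



section \<open>Displacements of the walk with positive probability\<close>

text \<open>
  The possible values of the displacement of the walk between the times \<open>n\<close> and \<open>m\<close>.
\<close>

definition sign_sums :: "(nat \<Rightarrow> nat) \<Rightarrow> nat \<Rightarrow> nat \<Rightarrow> int set" where
  "sign_sums a n m = {\<Sum>k\<in>{n<..m}. e k * int (a k) | e. \<forall>k. e k \<in> {1, -1}}"

lemma sign_sumsI:
  assumes "\<And>k. e k = 1 \<or> e k = -1" "x = (\<Sum>k\<in>{n<..m}. e k * int (a k))"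
  shows "x \<in> sign_sums a n m"
  unfolding sign_sums_def using assms by blast

lemma sign_sums_refl: "0 \<in> sign_sums a n n"
  by (rule sign_sumsI[of "\<lambda>_. 1"]) auto

lemma sign_sums_one:
  assumes "u = 1 \<or> u = -1"
  shows "u * int (a (Suc n)) \<in> sign_sums a n (Suc n)"
proof -
  have "{n<..Suc n} = {Suc n}" by auto
  then show ?thesis using assms by (intro sign_sumsI[of "\<lambda>_. u"]) auto
qed

lemma sign_sums_add:
  assumes "x \<in> sign_sums a n m" "y \<in> sign_sums a m p" "n \<le> m" "m \<le> p"
  shows "x + y \<in> sign_sums a n p"
proof -
  obtain e e' where e: "\<forall>k. e k \<in> {1, -1}" "x = (\<Sum>k\<in>{n<..m}. e k * int (a k))"
    and e': "\<forall>k. e' k \<in> {1, -1}" "y = (\<Sum>k\<in>{m<..p}. e' k * int (a k))"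
    using assms(1,2) unfolding sign_sums_def by blast
  have "(\<Sum>k\<in>{n<..p}. (if k \<le> m then e k else e' k) * int (a k)) =
      (\<Sum>k\<in>{n<..m}. (if k \<le> m then e k else e' k) * int (a k)) +
      (\<Sum>k\<in>{m<..p}. (if k \<le> m then e k else e' k) * int (a k))"
    using assms(3,4) by (subst sum.union_disjoint[symmetric]) (auto intro!: sum.cong)
  also have "\<dots> = x + y"
    unfolding e(2) e'(2) by (intro arg_cong2[of _ _ _ _ "(+)"] sum.cong) auto
  finally show ?thesis
    using e(1) e'(1) by (intro sign_sumsI[of "\<lambda>k. if k \<le> m then e k else e' k"]) auto
qed

lemma sign_sums_alternate:
  assumes "\<And>k. n < k \<Longrightarrow> k \<le> n + 2 * j \<Longrightarrow> a k = c"
  shows "0 \<in> sign_sums a n (n + 2 * j)"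
  using assms
proof (induction j)
  case 0
  then show ?case by (simp add: sign_sums_refl)
next
  case (Suc j)
  let ?p = "n + 2 * j"
  have "int c \<in> sign_sums a ?p (Suc ?p)" "- int c \<in> sign_sums a (Suc ?p) (Suc (Suc ?p))"
    using sign_sums_one[of 1 a ?p] sign_sums_one[of "-1" a "Suc ?p"] Suc.prems by auto
  then have "int c + - int c \<in> sign_sums a ?p (Suc (Suc ?p))"
    by (rule sign_sums_add) auto
  moreover have "0 \<in> sign_sums a n ?p" using Suc by auto
  ultimately have "0 + (int c + - int c) \<in> sign_sums a n (Suc (Suc ?p))"
    by (intro sign_sums_add[of 0 a n ?p]) auto
  then show ?case by simp
qed

section \<open>Block structure of the step sizes\<close>

text \<open>
  Block \<open>i\<close> consists of the times in \<open>{T i<..T (Suc i)}\<close>. Its length is odd, so that an even number of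
  steps, which can cancel in pairs, remains besides the first step and the last two; these three steps
  are the ones that take part in unit displacements.
\<close>

locale slow_steps =
  fixes T :: "nat \<Rightarrow> nat" and a :: "nat \<Rightarrow> nat"
  assumes T0: "T 0 = 0"
    and odd_length: "\<exists>j. T (Suc i) = T i + 2 * j + 3"
    and steps: "T i < k \<Longrightarrow> k \<le> T (Suc i) \<Longrightarrow> a k = step_size i"
begin

lemma T_less: "T i < T (Suc i)"
  using odd_length[of i] by auto

lemma strict_mono_T: "strict_mono T"
  by (simp add: strict_mono_Suc_iff T_less)

lemma block_exists:
  assumes "k > 0"
  shows "\<exists>i. T i < k \<and> k \<le> T (Suc i)"
proof -
  have ex: "\<exists>i. k \<le> T i" using strict_mono_imp_increasing[OF strict_mono_T] by blast
  define i where "i = (LEAST i. k \<le> T i)"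
  have i: "k \<le> T i" unfolding i_def using ex by (metis LeastI_ex)
  moreover have "i \<noteq> 0" using i assms T0 by (intro notI) simp
  then obtain i' where i': "i = Suc i'" using not0_implies_Suc by blast
  moreover have "T i' < k" using not_less_Least[of i' "\<lambda>i. k \<le> T i"] i' by (simp add: i_def)
  ultimately show ?thesis by blast
qed

lemma mono_steps: "mono_on {1..} a"
proof (rule mono_onI)
  fix k l :: nat assume kl: "k \<in> {1..}" "l \<in> {1..}" "k \<le> l"
  obtain i where i: "T i < k" "k \<le> T (Suc i)" using block_exists[of k] kl by auto
  obtain j where j: "T j < l" "l \<le> T (Suc j)" using block_exists[of l] kl by auto
  have "T i < T (Suc j)" using i j kl by linarith
  then have "i \<le> j" using strict_mono_T by (simp add: strict_mono_less)
  then show "a k \<le> a l" using steps[OF i] steps[OF j] by (simp add: mono_step_size)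
qed

text \<open>
  In block 0 the steps have size 1, so there the constant lower bound on \<open>f\<close> suffices.
\<close>

lemma steps_le:
  fixes f :: "nat \<Rightarrow> real"
  assumes "\<And>k. k \<ge> 1 \<Longrightarrow> f k \<ge> 1"
    and "\<And>i k. i > 0 \<Longrightarrow> k > T i \<Longrightarrow> f k \<ge> step_size i"
    and "k \<ge> 1"
  shows "real (a k) \<le> f k"
proof -
  obtain i where i: "T i < k" "k \<le> T (Suc i)" using block_exists[of k] assms(3) by auto
  then show ?thesis using steps[of i k] assms
    by (cases "i = 0") (auto simp: step_size_0)
qed

text \<open>
  Between the first steps of two consecutive blocks, the walk can move by \<open>u = \<plusminus>1\<close>: cancel all steps of
  block \<open>i\<close> but the last two, take these in direction \<open>-u\<close>, and take the first step of block
  \<open>i + 1\<close> in direction \<open>u\<close>. The total is \<open>u * (s\<^sub>i\<^sub>+\<^sub>1 - 2 * s\<^sub>i) = u\<close>.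
\<close>

lemma unit_move:
  assumes "u \<in> {1, -1 :: int}"
  shows "u \<in> sign_sums a (Suc (T i)) (Suc (T (Suc i)))"
proof -
  obtain j where j: "T (Suc i) = T i + 2 * j + 3" using odd_length by blast
  let ?p = "Suc (T i) + 2 * j" and ?c = "int (step_size i)"
  have 0: "0 \<in> sign_sums a (Suc (T i)) ?p"
    by (rule sign_sums_alternate[where c = "step_size i"]) (use j in \<open>intro steps[of i], auto\<close>)
  \<comment> \<open>A step in either direction at one of the last two times of block \<open>i\<close>.\<close>
  have 1: "v * ?c \<in> sign_sums a p (Suc p)" if "p = ?p \<or> p = Suc ?p" "v \<in> {1, -1}" for p v
    proof -
    have "a (Suc p) = step_size i"
      using that(1) j by (intro steps[of i]) auto
    then show ?thesis using sign_sums_one[of v a p] that(2) by auto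
  qed
  have "a (Suc (T (Suc i))) = step_size (Suc i)"
    using steps[of "Suc i" "Suc (T (Suc i))"] T_less[of "Suc i"] by simp
  then have 2: "u * int (step_size (Suc i)) \<in> sign_sums a (T (Suc i)) (Suc (T (Suc i)))"
    using sign_sums_one[of u a "T (Suc i)"] assms by auto
  have "-u * ?c + -u * ?c \<in> sign_sums a ?p (Suc (Suc ?p))"
    using 1[of ?p "-u"] 1[of "Suc ?p" "-u"] assms by (intro sign_sums_add[of _ a ?p "Suc ?p"]) auto
  moreover have "Suc (Suc ?p) = T (Suc i)" using j by simp
  ultimately have "0 + (-u * ?c + -u * ?c) \<in> sign_sums a (Suc (T i)) (T (Suc i))"
    using 0 by (metis sign_sums_add le_add1 le_SucI order_refl)
  then have "0 + (-u * ?c + -u * ?c) + u * int (step_size (Suc i)) 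
      \<in> sign_sums a (Suc (T i)) (Suc (T (Suc i)))"
    using T_less[of i] by (intro sign_sums_add[OF _ 2]) auto
  moreover have "0 + (-u * ?c + -u * ?c) + u * int (step_size (Suc i)) = u"
    by (simp add: step_size_Suc algebra_simps)
  ultimately show ?thesis by simp
qed

lemma reach_from_block_start:
  "\<exists>j\<ge>i. d \<in> sign_sums a (Suc (T i)) (Suc (T j))"
proof (induction "nat \<bar>d\<bar>" arbitrary: d i)
  case 0
  then show ?case by (auto intro!: exI[of _ i] simp: sign_sums_refl)
next
  case (Suc N)
  define u where "u = (if d > 0 then 1 else -1 :: int)"
  have "N = nat \<bar>d - u\<bar>" using Suc.hyps(2) by (auto simp: u_def)
  then obtain j where j: "j \<ge> Suc i" "d - u \<in> sign_sums a (Suc (T (Suc i))) (Suc (T j))"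
    using Suc.hyps(1) by blast
  have "u + (d - u) \<in> sign_sums a (Suc (T i)) (Suc (T j))"
    using j T_less[of i] strict_mono_less_eq[OF strict_mono_T, of "Suc i" j]
    by (intro sign_sums_add[OF unit_move]) (auto simp: u_def)
  then show ?case using j(1) by (intro exI[of _ j]) auto
qed

text \<open>
  Unit moves start just after the first step of a block. Running until such a time comes and then
  correcting the accumulated displacement by unit moves produces any \<open>d\<close>.
\<close>

lemma reach:
  "\<exists>m>n. d \<in> sign_sums a n m"
proof -
  define p where "p = Suc (T n)"
  have np: "n < p" using strict_mono_imp_increasing[OF strict_mono_T, of n] by (simp add: p_def)
  define x where "x = (\<Sum>k\<in>{n<..p}. 1 * int (a k))"
  have x: "x \<in> sign_sums a n p" unfolding x_def by (rule sign_sumsI[of "\<lambda>_. 1"]) auto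
  obtain j where j: "j \<ge> n" "d - x \<in> sign_sums a p (Suc (T j))"
    using reach_from_block_start[of n "d - x"] unfolding p_def by blast
  have "p \<le> Suc (T j)" using j(1) strict_mono_T by (simp add: p_def strict_mono_less_eq)
  then have "x + (d - x) \<in> sign_sums a n (Suc (T j))"
    using x j(2) np by (intro sign_sums_add) auto
  then show ?thesis using np \<open>p \<le> Suc (T j)\<close> by (intro exI[of _ "Suc (T j)"]) auto
qed

end


section \<open>The Rademacher walk modulo a step size\<close>

text \<open>
  The walk takes values in the reals, so a class modulo \<open>s\<close> is represented as a set of reals; a position
  that is not an integer lies in no class.
\<close>

definition residue_class :: "nat \<Rightarrow> int \<Rightarrow> real set" where
  "residue_class s r = of_int ` {y. [y = r] (mod int s)}"

lemma residue_class_borel [measurable]: "residue_class s r \<in> sets borel"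
  unfolding residue_class_def by (rule sets.countable) auto

lemma residue_class_iff:
  "x \<in> residue_class s r \<longleftrightarrow> (\<exists>y. x = of_int y \<and> [y = r] (mod int s))"
  unfolding residue_class_def by blast

lemma residue_class_cong: "[r = r'] (mod int s) \<Longrightarrow> residue_class s r = residue_class s r'"
proof -
  assume "[r = r'] (mod int s)"
  then have "[y = r] (mod int s) \<longleftrightarrow> [y = r'] (mod int s)" for y
    by (meson cong_sym cong_trans)
  then show ?thesis unfolding set_eq_iff residue_class_iff by simp
qed

lemma residue_class_shift:
  "x + of_int a \<in> residue_class s r \<longleftrightarrow> x \<in> residue_class s (r - a)"
proof -
  have "[y - a = r - a] (mod int s)" if "[y = r] (mod int s)" for y
    using that by (rule cong_diff) simp
  moreover have "[y + a = r] (mod int s)" if "[y = r - a] (mod int s)" for y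
    using cong_add[OF that cong_refl[of a]] by simp
  ultimately show ?thesis
    unfolding residue_class_iff
    by (metis add_diff_cancel_right' diff_add_cancel of_int_add of_int_diff)
qed

lemma disjoint_residue_classes: "disjoint_family_on (\<lambda>r. residue_class s (int r)) {..<s}"
  unfolding disjoint_family_on_def
proof (intro ballI impI)
  fix i j assume ij: "i \<in> {..<s}" "j \<in> {..<s}" "i \<noteq> j"
  have False if "[y = int i] (mod int s)" "[y = int j] (mod int s)" for y
  proof -
    have "[int i = int j] (mod int s)" using that by (meson cong_sym cong_trans)
    then show False using ij by (simp add: cong_int_iff cong_less_modulus_unique_nat)
  qed
  then show "residue_class s (int i) \<inter> residue_class s (int j) = {}"
    unfolding residue_class_iff disjoint_iff by auto
qed

context rademacher_sequence
begin

lemma sign_measurable: "k \<ge> 1 \<Longrightarrow> \<epsilon> k \<in> borel_measurable M"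
  using indep by (auto simp: indep_vars_def)

lemma walk_measurable: "rademacher_walk \<epsilon> a n \<in> borel_measurable M"
  unfolding rademacher_walk_def
  by (intro borel_measurable_sum borel_measurable_times sign_measurable) auto

lemma AE_signs: "AE \<omega> in M. \<forall>k\<ge>1. \<epsilon> k \<omega> = 1 \<or> \<epsilon> k \<omega> = -1"
proof -
  have "AE \<omega> in M. \<epsilon> k \<omega> = 1 \<or> \<epsilon> k \<omega> = -1" if k: "k \<ge> 1" for k
  proof -
    note [measurable] = sign_measurable[OF k]
    have "prob ({\<omega> \<in> space M. \<epsilon> k \<omega> = 1} \<union> {\<omega> \<in> space M. \<epsilon> k \<omega> = -1}) = 1/2 + 1/2"
      unfolding prob_plus[OF k, symmetric]
      by (subst finite_measure_Union) (auto simp: prob_plus[OF k] prob_minus[OF k])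
    also have "{\<omega> \<in> space M. \<epsilon> k \<omega> = 1} \<union> {\<omega> \<in> space M. \<epsilon> k \<omega> = -1} =
        {\<omega> \<in> space M. \<epsilon> k \<omega> = 1 \<or> \<epsilon> k \<omega> = -1}" by auto
    finally show ?thesis by (subst prob_Collect_eq_1[symmetric]) auto
  qed
  then show ?thesis by (simp add: AE_all_countable)
qed

lemma walk_int:
  assumes "\<forall>k\<ge>1. \<epsilon> k \<omega> = 1 \<or> \<epsilon> k \<omega> = -1"
  shows "rademacher_walk \<epsilon> (\<lambda>n. real (a n)) n \<omega> =
    of_int (\<Sum>k\<in>{0<..n}. (if \<epsilon> k \<omega> = 1 then 1 else -1) * int (a k))"
proof -
  have "\<epsilon> k \<omega> = of_int (if \<epsilon> k \<omega> = 1 then 1 else -1)" if "k \<ge> 1" for k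
    using assms that by auto
  then have "(\<Sum>k=1..n. \<epsilon> k \<omega> * real (a k)) =
      (\<Sum>k=1..n. of_int (if \<epsilon> k \<omega> = 1 then 1 else -1) * real (a k))"
    by (intro sum.cong) auto
  moreover have "{1..n} = {0<..n}" by auto
  ultimately show ?thesis by (simp add: rademacher_walk_def)
qed

lemma prob_sign_pattern_pos:
  assumes e: "\<And>k. e k = 1 \<or> e k = (-1::real)"
  shows "prob {\<omega> \<in> space M. \<forall>k\<in>{0<..n}. \<epsilon> k \<omega> = e k} > 0"
proof (cases "n = 0")
  case True
  then show ?thesis by (simp add: prob_space)
next
  case False
  then have ne: "{0<..n} \<noteq> {}" by auto
  have "prob (\<Inter>k\<in>{0<..n}. \<epsilon> k -` {e k} \<inter> space M) =
      (\<Prod>k\<in>{0<..n}. prob (\<epsilon> k -` {e k} \<inter> space M))"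
    by (rule indep_varsD[OF indep]) (use ne in auto)
  also have "\<dots> > 0"
  proof (rule prod_pos)
    fix k assume "k \<in> {0<..n}"
    then have k: "k \<ge> 1" by auto
    have "\<epsilon> k -` {e k} \<inter> space M = {\<omega> \<in> space M. \<epsilon> k \<omega> = e k}" by auto
    then show "prob (\<epsilon> k -` {e k} \<inter> space M) > 0"
      using e[of k] prob_plus[OF k] prob_minus[OF k] by auto
  qed
  also have "(\<Inter>k\<in>{0<..n}. \<epsilon> k -` {e k} \<inter> space M) =
      {\<omega> \<in> space M. \<forall>k\<in>{0<..n}. \<epsilon> k \<omega> = e k}"
    using ne by auto
  finally show ?thesis .
qed

text \<open>
  A position of positive probability at time \<open>n\<close> is attained under some sign pattern of length \<open>n\<close>. A
  pattern for the displacement \<open>y - x\<close> extends it to a pattern of finite length \<open>m\<close>, and finite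
  patterns have positive probability.
\<close>

lemma irreducible_walk_if_reach:
  assumes reach: "\<And>n d. \<exists>m>n. d \<in> sign_sums a n m"
  shows "irreducible_walk M (rademacher_walk \<epsilon> (\<lambda>n. real (a n)))"
  unfolding irreducible_walk_def
proof (intro allI impI)
  let ?X = "rademacher_walk \<epsilon> (\<lambda>n. real (a n))"
  fix x y :: int and n
  assume pos: "\<P>(\<omega> in M. ?X n \<omega> = of_int x) > 0"
  note [measurable] = walk_measurable
  have "\<not> (AE \<omega> in M. ?X n \<omega> \<noteq> of_int x)"
    using pos prob_Collect_eq_0[of "\<lambda>\<omega>. ?X n \<omega> = of_int x"] by auto
  then have "\<not> (AE \<omega> in M. \<not> ((\<forall>k\<ge>1. \<epsilon> k \<omega> = 1 \<or> \<epsilon> k \<omega> = -1) \<and> ?X n \<omega> = of_int x))"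
  proof (rule contrapos_nn)
    assume "AE \<omega> in M. \<not> ((\<forall>k\<ge>1. \<epsilon> k \<omega> = 1 \<or> \<epsilon> k \<omega> = -1) \<and> ?X n \<omega> = of_int x)"
    with AE_signs show "AE \<omega> in M. ?X n \<omega> \<noteq> of_int x"
      by eventually_elim blast
  qed
  then have "\<exists>\<omega>. (\<forall>k\<ge>1. \<epsilon> k \<omega> = 1 \<or> \<epsilon> k \<omega> = -1) \<and> ?X n \<omega> = of_int x"
    by (rule contrapos_np) (intro AE_I2, blast)
  then obtain \<omega>0 where \<omega>0: "\<forall>k\<ge>1. \<epsilon> k \<omega>0 = 1 \<or> \<epsilon> k \<omega>0 = -1" "?X n \<omega>0 = of_int x"
    by blast
  define e0 where "e0 k = (if \<epsilon> k \<omega>0 = 1 then 1 else -1 :: int)" for k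
  have x: "x = (\<Sum>k\<in>{0<..n}. e0 k * int (a k))"
    using trans[OF sym[OF \<omega>0(2)] walk_int[OF \<omega>0(1)]] unfolding e0_def of_int_eq_iff .
  obtain m where m: "m > n" "y - x \<in> sign_sums a n m" using reach by blast
  then obtain e1 where e1: "\<forall>k. e1 k \<in> {1, -1 :: int}" "y - x = (\<Sum>k\<in>{n<..m}. e1 k * int (a k))"
    unfolding sign_sums_def by blast
  define e where "e k = (if k \<le> n then e0 k else e1 k)" for k
  have e: "e k = 1 \<or> e k = -1" for k using e1(1) by (auto simp: e_def e0_def)
  have xn: "(\<Sum>k\<in>{0<..n}. e k * int (a k)) = x"
    unfolding x by (intro sum.cong) (auto simp: e_def)
  have "{0<..m} = {0<..n} \<union> {n<..m}" using m(1) by auto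
  then have "(\<Sum>k\<in>{0<..m}. e k * int (a k)) = x + (\<Sum>k\<in>{n<..m}. e k * int (a k))"
    using xn by (simp add: sum.union_disjoint)
  also have "(\<Sum>k\<in>{n<..m}. e k * int (a k)) = y - x"
    unfolding e1(2) by (intro sum.cong) (auto simp: e_def)
  finally have ym: "(\<Sum>k\<in>{0<..m}. e k * int (a k)) = y" by simp
  have walk: "?X j \<omega> = of_int (\<Sum>k\<in>{0<..j}. e k * int (a k))"
    if "\<forall>k\<in>{0<..m}. \<epsilon> k \<omega> = of_int (e k)" "j \<le> m" for j \<omega>
  proof -
    have "{1..j} = {0<..j}" by auto
    then show ?thesis using that by (simp add: rademacher_walk_def)
  qed
  have "0 < prob {\<omega> \<in> space M. \<forall>k\<in>{0<..m}. \<epsilon> k \<omega> = of_int (e k)}"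
  proof (rule prob_sign_pattern_pos)
    show "real_of_int (e k) = 1 \<or> real_of_int (e k) = -1" for k using e[of k] by auto
  qed
  also have "\<dots> \<le> \<P>(\<omega> in M. ?X m \<omega> = of_int y \<and> ?X n \<omega> = of_int x)"
    using walk[of _ m] walk[of _ n] xn ym m(1) by (intro finite_measure_mono) auto
  finally show "\<exists>m>n. \<P>(\<omega> in M. ?X m \<omega> = of_int y \<bar> ?X n \<omega> = of_int x) > 0"
    using pos m(1) unfolding cond_prob_def by (intro exI[of _ m]) auto
qed

text \<open>
  Conditioning on the last step, which is independent of the walk so far, turns the walk into the
  averaging recursion that governs the mixing estimates.
\<close>

lemma prob_walk_Suc:
  assumes A: "A \<in> sets borel"
  shows "prob {\<omega> \<in> space M. rademacher_walk \<epsilon> a (Suc n) \<omega> \<in> A} =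
    (prob {\<omega> \<in> space M. rademacher_walk \<epsilon> a n \<omega> - a (Suc n) \<in> A} +
     prob {\<omega> \<in> space M. rademacher_walk \<epsilon> a n \<omega> + a (Suc n) \<in> A}) / 2"
proof -
  let ?X = "rademacher_walk \<epsilon> a" and ?c = "a (Suc n)"
  note [measurable] = walk_measurable sign_measurable A
  have m [measurable]: "\<epsilon> (Suc n) \<in> borel_measurable M" by simp
  \<comment> \<open>Weighting all signs but the last one makes \<open>?X n\<close> a plain sum of independent variables that is
    independent of the bare sign \<open>\<epsilon> (Suc n)\<close>.\<close>
  define g where "g k x = (if k = Suc n then x else x * a k)" for k and x :: real
  have "indep_vars (\<lambda>_. borel) (\<lambda>k \<omega>. g k (\<epsilon> k \<omega>)) (insert (Suc n) {1..n})"
    by (rule indep_vars_compose2[OF indep_vars_subset[OF indep]]) (auto simp: g_def)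
  then have "indep_var borel (\<lambda>\<omega>. g (Suc n) (\<epsilon> (Suc n) \<omega>)) borel (\<lambda>\<omega>. \<Sum>k=1..n. g k (\<epsilon> k \<omega>))"
    by (intro indep_vars_sum) auto
  moreover have "(\<lambda>\<omega>. \<Sum>k=1..n. g k (\<epsilon> k \<omega>)) = ?X n"
    unfolding rademacher_walk_def g_def by (intro ext sum.cong) auto
  moreover have "(\<lambda>\<omega>. g (Suc n) (\<epsilon> (Suc n) \<omega>)) = \<epsilon> (Suc n)" by (simp add: g_def)
  ultimately have ind: "indep_var borel (\<epsilon> (Suc n)) borel (?X n)" by simp
  have half: "prob {\<omega> \<in> space M. \<epsilon> (Suc n) \<omega> = u \<and> ?X n \<omega> + u * ?c \<in> A} =
      prob {\<omega> \<in> space M. ?X n \<omega> + u * ?c \<in> A} / 2" if "u = 1 \<or> u = -1" for u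
  proof -
    have "(\<lambda>x. x + u * ?c) -` A \<in> sets borel"
      using A measurable_sets_borel[of "\<lambda>x. x + u * ?c" borel A] by simp
    then have "prob ((\<lambda>\<omega>. (\<epsilon> (Suc n) \<omega>, ?X n \<omega>)) -` ({u} \<times> (\<lambda>x. x + u * ?c) -` A) \<inter> space M) =
        prob (\<epsilon> (Suc n) -` {u} \<inter> space M) * prob (?X n -` ((\<lambda>x. x + u * ?c) -` A) \<inter> space M)"
      by (intro indep_varD[OF ind]) auto
    moreover have "(\<lambda>\<omega>. (\<epsilon> (Suc n) \<omega>, ?X n \<omega>)) -` ({u} \<times> (\<lambda>x. x + u * ?c) -` A) \<inter> space M
        = {\<omega> \<in> space M. \<epsilon> (Suc n) \<omega> = u \<and> ?X n \<omega> + u * ?c \<in> A}" by auto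
    moreover have "\<epsilon> (Suc n) -` {u} \<inter> space M = {\<omega> \<in> space M. \<epsilon> (Suc n) \<omega> = u}" by auto
    moreover have "?X n -` ((\<lambda>x. x + u * ?c) -` A) \<inter> space M = {\<omega> \<in> space M. ?X n \<omega> + u * ?c \<in> A}"
      by auto
    ultimately show ?thesis
      using that prob_plus[of "Suc n"] prob_minus[of "Suc n"] by auto
  qed
  have "prob {\<omega> \<in> space M. ?X (Suc n) \<omega> \<in> A} =
      prob ({\<omega> \<in> space M. \<epsilon> (Suc n) \<omega> = -1 \<and> ?X n \<omega> + (-1) * ?c \<in> A} \<union>
            {\<omega> \<in> space M. \<epsilon> (Suc n) \<omega> = 1 \<and> ?X n \<omega> + 1 * ?c \<in> A})"
  proof (rule finite_measure_eq_AE)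
    show "AE \<omega> in M. \<omega> \<in> {\<omega> \<in> space M. ?X (Suc n) \<omega> \<in> A} \<longleftrightarrow>
        \<omega> \<in> {\<omega> \<in> space M. \<epsilon> (Suc n) \<omega> = -1 \<and> ?X n \<omega> + (-1) * ?c \<in> A} \<union>
            {\<omega> \<in> space M. \<epsilon> (Suc n) \<omega> = 1 \<and> ?X n \<omega> + 1 * ?c \<in> A}"
      using AE_signs
    proof eventually_elim
      case (elim \<omega>)
      have "?X (Suc n) \<omega> = ?X n \<omega> + \<epsilon> (Suc n) \<omega> * ?c" by (simp add: rademacher_walk_def)
      moreover have "\<epsilon> (Suc n) \<omega> = 1 \<or> \<epsilon> (Suc n) \<omega> = -1" using elim by simp
      ultimately show ?case by auto
    qed
  qed measurable
  also have "\<dots> = prob {\<omega> \<in> space M. \<epsilon> (Suc n) \<omega> = -1 \<and> ?X n \<omega> + (-1) * ?c \<in> A} +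
      prob {\<omega> \<in> space M. \<epsilon> (Suc n) \<omega> = 1 \<and> ?X n \<omega> + 1 * ?c \<in> A}"
    by (intro finite_measure_Union) auto
  finally show ?thesis using half[of 1] half[of "-1"] by simp
qed

text \<open>
  The threshold \<open>L\<close> has to work for all step sequences \<open>a\<close> and all starting times \<open>t\<close> at once: it must
  be known before the block boundaries, and hence \<open>a\<close> itself, can be chosen.
\<close>

definition spreads_within :: "nat \<Rightarrow> nat \<Rightarrow> nat \<Rightarrow> bool" where
  "spreads_within L c s \<longleftrightarrow> (\<forall>a t m r. L \<le> m \<longrightarrow> (\<forall>k. t < k \<longrightarrow> k \<le> t + m \<longrightarrow> a k = c) \<longrightarrow>
    prob {\<omega> \<in> space M. rademacher_walk \<epsilon> (\<lambda>n. real (a n)) (t + m) \<omega> \<in> residue_class s r} \<le> 2 / s)"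

lemma spreads_within_exists:
  assumes s: "odd s" "coprime c s"
  shows "\<exists>L. spreads_within L c s"
proof (rule averaging_mixes[OF s(1)])
  show "coprime (int c) (int s)" using s(2) by simp
next
  fix L
  assume L: "\<And>(q :: nat \<Rightarrow> int \<Rightarrow> real) m r. L \<le> m \<Longrightarrow>
     (\<And>k r. k < m \<Longrightarrow> q (Suc k) r = (q k (r - int c) + q k (r + int c)) / 2) \<Longrightarrow>
     (\<And>k r r'. [r = r'] (mod int s) \<Longrightarrow> q k r = q k r') \<Longrightarrow>
     (\<And>k. (\<Sum>r<s. q k (int r)) \<le> 1) \<Longrightarrow> (\<And>k r. q k r \<le> 1) \<Longrightarrow> q m r \<le> 2 / s"
  show ?thesis unfolding spreads_within_def
  proof (intro exI[of _ L] allI impI)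
    fix a :: "nat \<Rightarrow> nat" and t m r
    assume m: "L \<le> m" and a: "\<forall>k. t < k \<longrightarrow> k \<le> t + m \<longrightarrow> a k = c"
    let ?X = "rademacher_walk \<epsilon> (\<lambda>n. real (a n))"
    note [measurable] = walk_measurable
    define q where "q k r = prob {\<omega> \<in> space M. ?X (t + k) \<omega> \<in> residue_class s r}" for k r
    have "q m r \<le> 2 / s"
    proof (rule L[OF m])
      fix k r assume "k < m"
      then have ak: "a (Suc (t + k)) = c" using a by simp
      have "?X (t + k) \<omega> - real c \<in> residue_class s r \<longleftrightarrow> ?X (t + k) \<omega> \<in> residue_class s (r + int c)"
        for \<omega> using residue_class_shift[of "?X (t + k) \<omega>" "- int c"] by simp
      moreover have "?X (t + k) \<omega> + real c \<in> residue_class s r \<longleftrightarrow> ?X (t + k) \<omega> \<in> residue_class s (r - int c)"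
        for \<omega> using residue_class_shift[of "?X (t + k) \<omega>" "int c"] by simp
      ultimately show "q (Suc k) r = (q k (r - int c) + q k (r + int c)) / 2"
        unfolding q_def using prob_walk_Suc[OF residue_class_borel, of "\<lambda>n. real (a n)" "t + k" s r]
        by (simp add: ak)
    next
      fix k r r' assume "[r = r'] (mod int s)"
      then show "q k r = q k r'" unfolding q_def by (simp add: residue_class_cong[of r r'])
    next
      fix k
      have "(\<Sum>r<s. q k (int r)) =
          prob (\<Union>r\<in>{..<s}. {\<omega> \<in> space M. ?X (t + k) \<omega> \<in> residue_class s (int r)})"
        unfolding q_def
      proof (rule finite_measure_finite_Union[symmetric])
        show "disjoint_family_on
            (\<lambda>r. {\<omega> \<in> space M. ?X (t + k) \<omega> \<in> residue_class s (int r)}) {..<s}"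
          using disjoint_residue_classes[of s] unfolding disjoint_family_on_def by blast
      qed auto
      also have "\<dots> \<le> 1" by (rule prob_le_1)
      finally show "(\<Sum>r<s. q k (int r)) \<le> 1" .
    qed (simp add: q_def)
    then show "prob {\<omega> \<in> space M. ?X (t + m) \<omega> \<in> residue_class s r} \<le> 2 / s"
      by (simp add: q_def)
  qed
qed

section \<open>Transience\<close>

text \<open>
  A visit to \<open>[-c, c]\<close> during block \<open>i + 1\<close> forces the walk to be at time \<open>T (i + 1)\<close> in the class of a
  number between \<open>-c\<close> and \<open>c\<close> modulo the current step size. The probabilities of these events decay
  geometrically in \<open>i\<close>, so almost surely only finitely many of the finite blocks contain a visit.
\<close>

lemma transient_if_residues_spread:
  assumes "slow_steps T a"
    and spread: "\<And>i r. prob {\<omega> \<in> space M. rademacher_walk \<epsilon> (\<lambda>n. real (a n)) (T (Suc i)) \<omega>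
      \<in> residue_class (step_size (Suc i)) r} \<le> 2 / step_size (Suc i)"
  shows "transient M (rademacher_walk \<epsilon> (\<lambda>n. real (a n)))"
proof -
  interpret slow_steps T a by fact
  let ?X = "rademacher_walk \<epsilon> (\<lambda>n. real (a n))"
  note [measurable] = walk_measurable
  have finite_visits: "AE \<omega> in M. \<not> (\<exists>\<^sub>\<infinity>n. \<bar>?X n \<omega>\<bar> \<le> real c)" for c :: nat
  proof -
    \<comment> \<open>An event known at the start of block \<open>Suc i\<close> that contains all its visits to \<open>[-c, c]\<close>.\<close>
    define H where "H i = (\<Union>r\<in>{-int c..int c}.
      {\<omega> \<in> space M. ?X (T (Suc i)) \<omega> \<in> residue_class (step_size (Suc i)) r})" for i
    have H: "prob (H i) \<le> (2 * (2 * real c + 1)) * (1 / 2) ^ i" for i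
    proof -
      have "prob (H i) \<le> (\<Sum>r\<in>{-int c..int c}.
          prob {\<omega> \<in> space M. ?X (T (Suc i)) \<omega> \<in> residue_class (step_size (Suc i)) r})"
        unfolding H_def by (intro finite_measure_subadditive_finite) auto
      also have "\<dots> \<le> (\<Sum>r\<in>{-int c..int c}. 2 / step_size (Suc i))"
        by (intro sum_mono spread)
      also have "\<dots> = (2 * real c + 1) * (2 / step_size (Suc i))" by simp
      also have "\<dots> \<le> (2 * real c + 1) * (2 / 2 ^ i)"
      proof (intro mult_left_mono divide_left_mono)
        have "(2::nat) ^ i \<le> step_size (Suc i)"
          using step_size_ge[of i] by (simp add: step_size_Suc)
        then show "(2::real) ^ i \<le> step_size (Suc i)"
          by (metis of_nat_le_iff of_nat_numeral of_nat_power)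
        then show "0 < real (step_size (Suc i)) * 2 ^ i" by (simp add: step_size_Suc)
      qed auto
      finally show ?thesis by (simp add: field_simps)
    qed
    have "AE \<omega> in M. eventually (\<lambda>i. \<omega> \<in> space M - H i) sequentially"
    proof (rule borel_cantelli_AE1)
      show "summable (\<lambda>i. prob (H i))"
        by (rule summable_comparison_test'[where N = 0, OF summable_mult[OF summable_geometric]])
          (use H in auto)
    qed (auto simp: H_def less_top[symmetric])
    with AE_signs show ?thesis
    proof eventually_elim
      case (elim \<omega>)
      then obtain N where N: "\<And>i. i \<ge> N \<Longrightarrow> \<omega> \<in> space M - H i"
        by (auto simp: eventually_sequentially)
      have "\<not> \<bar>?X n \<omega>\<bar> \<le> real c" if n: "n > T (Suc N)" for n
      proof
        assume small: "\<bar>?X n \<omega>\<bar> \<le> real c"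
        obtain j where j: "T j < n" "n \<le> T (Suc j)" using block_exists[of n] n by auto
        \<comment> \<open>Time \<open>n\<close> lies in a block after block \<open>N\<close>, and since the entry time of this block all
          displacements have been multiples of its step size.\<close>
        have "T (Suc N) < T (Suc j)" using n j by linarith
        then have "Suc N \<le> j" using strict_mono_T by (simp add: strict_mono_less)
        then obtain i where i: "j = Suc i" "N \<le> i" by (cases j) auto
        define \<eta> where "\<eta> k = (if \<epsilon> k \<omega> = 1 then 1 else -1 :: int)" for k
        define x where "x n = (\<Sum>k\<in>{0<..n}. \<eta> k * int (a k))" for n
        have X: "?X n \<omega> = of_int (x n)" for n
          unfolding x_def \<eta>_def by (rule walk_int[OF elim(1)])
        have "{0<..n} = {0<..T j} \<union> {T j<..n}" using j by auto
        then have "x n = x (T j) + (\<Sum>k\<in>{T j<..n}. \<eta> k * int (a k))"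
          unfolding x_def by (simp add: sum.union_disjoint)
        also have "(\<Sum>k\<in>{T j<..n}. \<eta> k * int (a k)) = (\<Sum>k\<in>{T j<..n}. \<eta> k * int (step_size j))"
        proof (rule sum.cong)
          fix k assume "k \<in> {T j<..n}"
          then have "a k = step_size j" using j by (intro steps) auto
          then show "\<eta> k * int (a k) = \<eta> k * int (step_size j)" by simp
        qed simp
        also have "\<dots> = (\<Sum>k\<in>{T j<..n}. \<eta> k) * int (step_size j)" by (simp add: sum_distrib_right)
        finally have "[x (T j) = x n] (mod int (step_size j))"
          by (simp add: cong_def)
        then have "?X (T j) \<omega> \<in> residue_class (step_size j) (x n)"
          unfolding residue_class_iff X by blast
        moreover have "x n \<in> {-int c..int c}" using small unfolding X by auto
        ultimately show False using N[OF i(2)] unfolding H_def i(1) by blast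
      qed
      then show ?case unfolding INFM_nat by blast
    qed
  qed
  then have "AE \<omega> in M. \<forall>c::nat. \<not> (\<exists>\<^sub>\<infinity>n. \<bar>?X n \<omega>\<bar> \<le> real c)"
    by (simp add: AE_all_countable)
  then have never: "AE \<omega> in M. \<not> (\<exists>C::real. \<exists>\<^sub>\<infinity>n. \<bar>?X n \<omega>\<bar> \<le> C)"
  proof eventually_elim
    case (elim \<omega>)
    show ?case
    proof
      assume "\<exists>C::real. \<exists>\<^sub>\<infinity>n. \<bar>?X n \<omega>\<bar> \<le> C"
      then obtain C :: real where C: "\<exists>\<^sub>\<infinity>n. \<bar>?X n \<omega>\<bar> \<le> C" by blast
      obtain c :: nat where c: "C \<le> real c" using real_arch_simple by blast
      have "\<exists>\<^sub>\<infinity>n. \<bar>?X n \<omega>\<bar> \<le> real c"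
        using C by (rule INFM_mono) (use c in linarith)
      with elim show False by blast
    qed
  qed
  have ev: "{\<omega> \<in> space M. \<exists>C::real. \<exists>\<^sub>\<infinity>n. \<bar>?X n \<omega>\<bar> \<le> C} \<in> sets M"
    by (rule weakly_recurrent_event_measurable) unfold_locales
  show ?thesis
    unfolding transient_def weakly_recurrent_def
    using never unfolding prob_Collect_eq_0[OF ev, symmetric] by simp
qed

end


section \<open>Arbitrarily slow irreducible transient walks\<close>

lemma slow_steps_exist:
  fixes L :: "nat \<Rightarrow> nat"
  shows "\<exists>T a. slow_steps T a \<and> (\<forall>i. T i + L i \<le> T (Suc i))"
proof -
  define T where "T = rec_nat 0 (\<lambda>i t. t + 2 * L i + 3)"
  have T: "T 0 = 0" "T (Suc i) = T i + 2 * L i + 3" for i by (simp_all add: T_def)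
  have mono: "strict_mono T" by (simp add: strict_mono_Suc_iff T)
  define a where "a k = step_size (LEAST i. k \<le> T (Suc i))" for k
  have "slow_steps T a"
  proof
    fix i k assume k: "T i < k" "k \<le> T (Suc i)"
    have "(LEAST i. k \<le> T (Suc i)) = i"
    proof (rule Least_equality)
      fix j assume "k \<le> T (Suc j)"
      then have "T i < T (Suc j)" using k by linarith
      then show "i \<le> j" using mono by (simp add: strict_mono_less)
    qed (rule k)
    then show "a k = step_size i" by (simp add: a_def)
  qed (auto simp: T)
  then show ?thesis using T by (intro exI[of _ T] exI[of _ a]) auto
qed

theorem lemma9:
  fixes M :: "'a measure" and \<epsilon> :: "nat \<Rightarrow> 'a \<Rightarrow> real" and f :: "nat \<Rightarrow> real"
  assumes "rademacher_sequence M \<epsilon>"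
    and "\<And>n. n \<ge> 1 \<Longrightarrow> f n \<ge> 1"
    and "filterlim f at_top sequentially"
  shows "\<exists>a :: nat \<Rightarrow> nat.
           mono_on {1..} a \<and>
           (\<forall>n\<ge>1. real (a n) \<le> f n) \<and>
           irreducible_walk M (rademacher_walk \<epsilon> (\<lambda>n. real (a n))) \<and>
           transient M (rademacher_walk \<epsilon> (\<lambda>n. real (a n)))"
proof -
  interpret rademacher_sequence M \<epsilon> by fact
  have "\<forall>i. \<exists>L. spreads_within L (step_size i) (step_size (Suc i))"
    by (intro allI spreads_within_exists odd_step_size coprime_step_size)
  from choice[OF this] obtain L
    where L: "\<And>i. spreads_within (L i) (step_size i) (step_size (Suc i))" by blast
  \<comment> \<open>Block \<open>i\<close> has to last for the mixing time \<open>L i\<close>, and until \<open>f\<close> permits the next step size.\<close>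
  have "\<exists>K. \<forall>k\<ge>K. real (step_size i) \<le> f k" for i
    using assms(3) unfolding filterlim_at_top eventually_sequentially by blast
  then obtain K where K: "\<And>i k. K i \<le> k \<Longrightarrow> real (step_size i) \<le> f k" by metis
  obtain T a where slow: "slow_steps T a" and T: "\<And>i. T i + (L i + K (Suc i)) \<le> T (Suc i)"
    using slow_steps_exist[of "\<lambda>i. L i + K (Suc i)"] by blast
  interpret slow_steps T a by fact
  show ?thesis
  proof (intro exI[of _ a] conjI allI impI)
    show "mono_on {1..} a" by (rule mono_steps)
  next
    fix n :: nat assume n: "n \<ge> 1"
    show "real (a n) \<le> f n"
    proof (rule steps_le[OF assms(2)])
      fix i k assume "0 < i" "T i < k"
      then show "real (step_size i) \<le> f k"
        using T[of "i - 1"] by (intro K) auto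
    qed (use n in auto)
  next
    show "irreducible_walk M (rademacher_walk \<epsilon> (\<lambda>n. real (a n)))"
      by (rule irreducible_walk_if_reach) (rule reach)
  next
    show "transient M (rademacher_walk \<epsilon> (\<lambda>n. real (a n)))"
    proof (rule transient_if_residues_spread[OF slow])
      fix i r
      have len: "T i + (T (Suc i) - T i) = T (Suc i)" "L i \<le> T (Suc i) - T i"
        using T[of i] by auto
      have "\<forall>k. T i < k \<longrightarrow> k \<le> T i + (T (Suc i) - T i) \<longrightarrow> a k = step_size i"
        unfolding len(1) using steps by blast
      with L[of i] len(2) have "prob {\<omega> \<in> space M. rademacher_walk \<epsilon> (\<lambda>n. real (a n))
            (T i + (T (Suc i) - T i)) \<omega> \<in> residue_class (step_size (Suc i)) r}
          \<le> 2 / step_size (Suc i)"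
        unfolding spreads_within_def by blast
      then show "prob {\<omega> \<in> space M. rademacher_walk \<epsilon> (\<lambda>n. real (a n)) (T (Suc i)) \<omega>
          \<in> residue_class (step_size (Suc i)) r} \<le> 2 / step_size (Suc i)"
        unfolding len(1) .
    qed
  qed
qed

end
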